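(* Let $n=3\nu$ be odd, where $\nu\ge 3$. For $i\in\{1,2,3\}$ let $a^i\in\{0,1\}^n$ be the row vector with support $\{i,i+3,\dots,i+3(\nu-1)\}$. If $E$ is the matrix obtained from $\mathscr{C}_n^2$ by appending to it the rows $a^1$, $a^2$ and $a^3$, then $E$ is minimally nonideal.
   Context: $\mathscr{C}_n^2$ is the $n\times n$ binary matrix whose $t$-th row is the characteristic vector of $\{t,t+1\}$ (indices modulo $n$ with values in $\{1,\dots,n\}$), $t=1,\dots,n$. For a binary matrix $A$ with $n$ columns, $Q(A)=\{x\in\mathbb{R}^n\mid Ax\ge\mathbf{1},\ x\ge\mathbf{0}\}$ and $Q^*(A)=\operatorname{conv}\{x\in\mathbb{Z}^n\mid Ax\ge\mathbf{1},\ x\ge\mathbf{0}\}$. $A$ is ideal if $Q(A)=Q^*(A)$, and minimally nonideal if it is not ideal but $Q(A)\cap\{x\mid x_i=0\}$ and $Q(A)\cap\{x\mid x_i=1\}$ are integral polyhedra for all $i\in\{1,\dots,n\}$. A polyhedron contained in the nonnegative orthant is integral if all its vertices are integral (the empty set being integral). *)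

theory Defs
  imports "HOL-Analysis.Analysis"
begin

definition char_vec :: "'n set \<Rightarrow> real^'n" where
  "char_vec S = (\<chi> j. indicator S j)"

definition binary_matrix :: "real^'n^'m \<Rightarrow> bool" where
  "binary_matrix A \<longleftrightarrow> (\<forall>i j. A $ i $ j \<in> {0, 1})"

definition integral_vec :: "real^'n \<Rightarrow> bool" where
  "integral_vec x \<longleftrightarrow> (\<forall>j. x $ j \<in> \<int>)"

text \<open>In the next two definitions \<open>0\<close> and \<open>1\<close> are the constant vectors and \<open>\<le>\<close> is the
  componentwise order.\<close>

definition Q :: "real^'n^'m \<Rightarrow> (real^'n) set" where
  "Q A = {x. 1 \<le> A *v x \<and> 0 \<le> x}"

definition Q_star :: "real^'n^'m \<Rightarrow> (real^'n) set" where
  "Q_star A = convex hull {x. integral_vec x \<and> 1 \<le> A *v x \<and> 0 \<le> x}"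

definition ideal_matrix :: "real^'n^'m \<Rightarrow> bool" where
  "ideal_matrix A \<longleftrightarrow> Q A = Q_star A"

text \<open>Vertices of a polyhedron are its extreme points. Integrality of all vertices is an adequate
  notion of integrality only for pointed polyhedra; it is applied below to subsets of the
  nonnegative orthant.\<close>

definition integral_polyhedron :: "(real^'n) set \<Rightarrow> bool" where
  "integral_polyhedron P \<longleftrightarrow>
     polyhedron P \<and> (\<forall>x. x extreme_point_of P \<longrightarrow> integral_vec x)"

definition minimally_nonideal :: "real^'n^'m \<Rightarrow> bool" where
  "minimally_nonideal A \<longleftrightarrow>
     binary_matrix A \<and> \<not> ideal_matrix A \<and>
     (\<forall>i. integral_polyhedron (Q A \<inter> {x. x $ i = 0}) \<and>
          integral_polyhedron (Q A \<inter> {x. x $ i = 1}))"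

text \<open>A bijection \<open>\<phi>\<close> from \<open>{1..n}\<close> onto the index type \<open>'n\<close> numbers the coordinates of
  \<open>real^'n\<close>; coordinate \<open>t\<close> is \<open>\<phi> t\<close>. The cyclic successor of \<open>t\<close> in \<open>{1..n}\<close> is
  \<open>t mod n + 1\<close>.\<close>

definition circulant2 :: "(nat \<Rightarrow> 'n) \<Rightarrow> nat \<Rightarrow> real^'n^'n" where
  "circulant2 \<phi> n =
     (\<chi> r. let t = the_inv_into {1..n} \<phi> r in char_vec {\<phi> t, \<phi> (t mod n + 1)})"

lemma circulant2_row:
  assumes "bij_betw \<phi> {1..n} (UNIV :: 'n::finite set)" and "t \<in> {1..n}"
  shows "circulant2 \<phi> n $ \<phi> t = char_vec {\<phi> t, \<phi> (t mod n + 1)}"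
  using assms by (simp add: circulant2_def Let_def bij_betw_def the_inv_into_f_f)

definition step3_row :: "(nat \<Rightarrow> 'n) \<Rightarrow> nat \<Rightarrow> nat \<Rightarrow> real^'n" where
  "step3_row \<phi> \<nu> i = char_vec {\<phi> (i + 3 * j) | j. j < \<nu>}"

definition append_rows :: "real^'n^'m \<Rightarrow> real^'n^'k \<Rightarrow> real^'n^('m + 'k)" where
  "append_rows A B = (\<chi> r. case r of Inl i \<Rightarrow> A $ i | Inr i \<Rightarrow> B $ i)"

definition E_matrix :: "(nat \<Rightarrow> 'n) \<Rightarrow> nat \<Rightarrow> real^'n^('n + 3)" where
  "E_matrix \<phi> \<nu> =
     append_rows (circulant2 \<phi> (3 * \<nu>))
       (vector [step3_row \<phi> \<nu> 1, step3_row \<phi> \<nu> 2, step3_row \<phi> \<nu> 3])"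

end

theory Submission
  imports Defs
begin

text \<open>
  Number the vertices of the cycle of length \<open>n = 3 * \<nu>\<close> by residues modulo \<open>n\<close>. A point of \<open>Q E\<close> is
  a fractional vertex cover of this odd cycle whose weight on each residue class modulo 3 is at
  least 1.

  \<^emph>\<open>E is not ideal.\<close> The constant vector \<open>1/2\<close> lies in \<open>Q E\<close> and has total weight \<open>n/2\<close>. Summing
  the edge constraints shows that every integral point has weight at least \<open>n/2\<close>, hence at least
  \<open>(n + 1)/2\<close> because \<open>n\<close> is odd, and this bound persists on the convex hull
  (\<open>E_matrix_not_ideal\<close>).

  \<^emph>\<open>Both minors are integral.\<close> Let \<open>x\<close> be a point of \<open>Q E\<close> with some integral coordinate \<open>x_i\<close>. If \<open>x\<close> is not integral, there is a nonzero direction \<open>d\<close> that vanishes at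
  \<open>i\<close> and along which every tight constraint stays tight, so \<open>x\<close> is not an extreme point
  (\<open>extreme_point_tight_direction\<close>). To find \<open>d\<close>
  (\<open>fractional_cover_has_tight_direction\<close>), cut the cycle at \<open>i\<close> and look at the fractional
  coordinates. Alternating signs on these keep all tight edges tight, since a tight edge
  has either two fractional ends or none. The signs may moreover be scaled independently on
  unions of components of the graph of tight edges. Only the tight class constraints remain, and
  there is at most one, since two classes together contain the ends of \<open>\<nu>\<close> disjoint edges and so have weight
  at least \<open>\<nu> \<ge> 3 > 2\<close> (\<open>two_classes_not_both_tight\<close>).

  \<^item> If the fractional coordinates have two or more components, two independent directions are
    available and some nontrivial combination satisfies the one remaining equation.

  \<^item> If they form one path of tight edges, the values along it alternate between \<open>\<alpha>\<close> and
    \<open>1 - \<alpha>\<close>. Members of a residue class modulo 3 on the path also alternate, as consecutive ones are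
    an odd distance apart, so the direction sums to \<open>T \<in> {-1, 0, 1}\<close> on the class. The weight of a tight class
    is congruent to \<open>\<plusminus>T * \<alpha>\<close> modulo 1 and equals 1, which forces \<open>T = 0\<close>
    (\<open>single_run_direction_vanishes_on_class\<close>).
\<close>

section \<open>Extreme points and tight constraints\<close>

lemma Q_fixed_coordinate_polyhedron:
  fixes A :: "real^'n^'m"
  shows "polyhedron (Q A \<inter> {x. x $ i = c})"
proof -
  have "Q A \<inter> {x. x $ i = c} =
      \<Inter>(range (\<lambda>r. {x. A $ r \<bullet> x \<ge> 1})) \<inter> \<Inter>(range (\<lambda>j. {x. axis j 1 \<bullet> x \<ge> 0}))
      \<inter> {x. axis i 1 \<bullet> x = c}"
    by (auto simp: Q_def less_eq_vec_def matrix_vector_mul_component inner_axis')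
  also have "polyhedron \<dots>"
    by (intro polyhedron_Int polyhedron_Inter polyhedron_hyperplane)
       (auto simp: polyhedron_halfspace_ge)
  finally show ?thesis .
qed

lemma small_step_keeps_bound:
  fixes b u v :: real
  assumes "b \<le> u" and "u = b \<Longrightarrow> v = 0"
  shows "\<forall>\<^sub>F e in at_right 0. b \<le> u + e * v \<and> b \<le> u - e * v"
proof (cases "u = b")
  case True
  with assms show ?thesis by simp
next
  case False
  with assms have "b < u" by simp
  have "((\<lambda>e. u + e * v) \<longlongrightarrow> u + 0 * v) (at_right 0)" "((\<lambda>e. u - e * v) \<longlongrightarrow> u - 0 * v) (at_right 0)"
    by (intro tendsto_intros)+
  with \<open>b < u\<close> have "\<forall>\<^sub>F e in at_right 0. b < u + e * v" "\<forall>\<^sub>F e in at_right 0. b < u - e * v"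
    by (auto dest: order_tendstoD(1))
  then show ?thesis by eventually_elim simp
qed

text \<open>Tight constraints do not change along \<open>d\<close>, and the finitely many others have some slack, so a
  single small step in the directions \<open>d\<close> and \<open>- d\<close> respects them all; an extreme point is not the midpoint of such a step.\<close>

lemma extreme_point_tight_direction:
  fixes A :: "real^'n^'m"
  assumes ext: "x extreme_point_of (Q A \<inter> {x. x $ i = c})"
    and fixed: "d $ i = 0"
    and rows: "\<And>r. (A *v x) $ r = 1 \<Longrightarrow> (A *v d) $ r = 0"
    and coords: "\<And>j. x $ j = 0 \<Longrightarrow> d $ j = 0"
  shows "d = 0"
proof -
  have x: "x \<in> Q A" "x $ i = c"
    using ext by (auto simp: extreme_point_of_def)
  then have ge: "\<And>r. 1 \<le> (A *v x) $ r" "\<And>j. 0 \<le> x $ j"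
    by (auto simp: Q_def less_eq_vec_def)
  have "\<forall>\<^sub>F e in at_right 0. \<forall>r. 1 \<le> (A *v x) $ r + e * (A *v d) $ r \<and> 1 \<le> (A *v x) $ r - e * (A *v d) $ r"
    by (intro eventually_all_finite small_step_keeps_bound ge rows)
  moreover have "\<forall>\<^sub>F e in at_right 0. \<forall>j. 0 \<le> x $ j + e * d $ j \<and> 0 \<le> x $ j - e * d $ j"
    by (intro eventually_all_finite small_step_keeps_bound ge coords)
  moreover have "\<forall>\<^sub>F e in at_right (0::real). 0 < e"
    by (simp add: eventually_at_right_less)
  ultimately have "\<forall>\<^sub>F e in at_right 0. 0 < e \<and> x + e *\<^sub>R d \<in> Q A \<and> x - e *\<^sub>R d \<in> Q A"
    by eventually_elim
      (simp add: Q_def less_eq_vec_def matrix_vector_right_distrib matrix_vector_mult_diff_distrib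
        matrix_vector_mult_scaleR)
  then obtain e where e: "0 < e" "x + e *\<^sub>R d \<in> Q A" "x - e *\<^sub>R d \<in> Q A"
    by (metis (no_types, lifting) eventually_happens trivial_limit_at_right_real)
  show ?thesis
  proof (rule ccontr)
    assume "d \<noteq> 0"
    with e(1) have "x + e *\<^sub>R d \<noteq> x - e *\<^sub>R d"
      by (simp add: eq_diff_eq add.assoc flip: scaleR_2)
    moreover have "x = midpoint (x + e *\<^sub>R d) (x - e *\<^sub>R d)"
      by (simp add: midpoint_def flip: scaleR_2)
    ultimately have "x \<in> open_segment (x + e *\<^sub>R d) (x - e *\<^sub>R d)"
      by (metis midpoint_in_open_segment)
    with ext e x(2) fixed show False
      by (auto simp: extreme_point_of_def)
  qed
qed

section \<open>Residue classes modulo 3 on the cycle\<close>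

definition residue_class :: "nat \<Rightarrow> nat \<Rightarrow> nat set" where
  "residue_class n r = {p. p < n \<and> p mod 3 = r}"

lemma finite_residue_class [simp]: "finite (residue_class n r)"
  by (simp add: residue_class_def)

lemma sum_residue_class:
  assumes "r < 3"
  shows "sum f (residue_class (3 * \<nu>) r) = (\<Sum>j<\<nu>. f (r + 3 * j))"
  using assms
  by (intro sum.reindex_bij_witness[where i = "\<lambda>j. r + 3 * j" and j = "\<lambda>p. p div 3"])
     (auto simp: residue_class_def)

text \<open>Any two distinct residue classes modulo 3 are cyclically consecutive, so the \<open>\<nu>\<close> edges from one to the
  next are disjoint and cover both classes exactly.\<close>

lemma two_classes_not_both_tight:
  fixes y :: "nat \<Rightarrow> real"
  assumes \<nu>: "\<nu> \<ge> 3" and period: "y (3 * \<nu>) = y 0"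
    and edge: "\<And>p. p < 3 * \<nu> \<Longrightarrow> 1 \<le> y p + y (Suc p)"
    and r: "r < 3" "sum y (residue_class (3 * \<nu>) r) = 1"
    and r': "r' < 3" "sum y (residue_class (3 * \<nu>) r') = 1"
  shows "r = r'"
proof -
  have main: "sum y (residue_class (3 * \<nu>) s) + sum y (residue_class (3 * \<nu>) (Suc s mod 3)) \<ge> \<nu>"
    if "s < 3" for s
  proof -
    have "sum y (residue_class (3 * \<nu>) (Suc s mod 3)) = (\<Sum>j<\<nu>. y (Suc s + 3 * j))"
    \<comment> \<open>The successors of class 2 form class 0 shifted by one period, with \<open>3 * \<nu>\<close> in place of 0.\<close>
    proof (cases "s = 2")
      case True
      have "(\<Sum>j<\<nu>. y (3 * Suc j)) + y 0 = (\<Sum>j<Suc \<nu>. y (3 * j))"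
        by (subst sum.lessThan_Suc_shift) simp
      with period True show ?thesis
        by (simp add: sum_residue_class)
    next
      case False
      with that have "Suc s mod 3 = Suc s" "Suc s < 3" by auto
      then show ?thesis by (simp add: sum_residue_class)
    qed
    then have "sum y (residue_class (3 * \<nu>) s) + sum y (residue_class (3 * \<nu>) (Suc s mod 3))
        = (\<Sum>j<\<nu>. y (s + 3 * j) + y (Suc (s + 3 * j)))"
      using that by (simp add: sum_residue_class sum.distrib)
    also have "\<dots> \<ge> (\<Sum>j<\<nu>. 1)"
      using that by (intro sum_mono edge) auto
    finally show ?thesis by simp
  qed
  have "r' \<noteq> Suc r mod 3"
  proof
    assume "r' = Suc r mod 3"
    with main[OF r(1)] r(2) r'(2) have "real \<nu> \<le> 2" by simp
    with \<nu> show False by simp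
  qed
  moreover have "r \<noteq> Suc r' mod 3"
  proof
    assume "r = Suc r' mod 3"
    with main[OF r'(1)] r(2) r'(2) have "real \<nu> \<le> 2" by simp
    with \<nu> show False by simp
  qed
  moreover have "r = 0 \<or> r = 1 \<or> r = 2" "r' = 0 \<or> r' = 1 \<or> r' = 2"
    using r(1) r'(1) by linarith+
  ultimately show ?thesis
    by (elim disjE) simp_all
qed

text \<open>The class of \<open>r\<close> has \<open>(m + 2 - r) div 3\<close> members below \<open>m\<close>, and the signs at consecutive
  members are opposite because 3 is odd.\<close>

lemma alternating_sum_residue_class:
  assumes "r < 3"
  shows "(\<Sum>p<m. if p mod 3 = r then (-1) ^ p else (0::real)) =
         (if even ((m + 2 - r) div 3) then 0 else (-1) ^ r)"
proof (induction m)
  case 0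
  then show ?case by simp
next
  case (Suc m)
  show ?case
  proof (cases "m mod 3 = r")
    case True
    then obtain q where m: "m = r + 3 * q"
      by (metis mod_mult_div_eq)
    then have "(m + 2 - r) div 3 = q" "(Suc m + 2 - r) div 3 = Suc q"
      by auto
    moreover have "(-1) ^ m = (-1) ^ r * (-1 :: real) ^ q"
      by (simp add: m power_add power_mult)
    ultimately show ?thesis
      using True Suc by (cases "even q") simp_all
  next
    case False
    have "(Suc m + 2 - r) div 3 = (m + 2 - r) div 3"
    proof -
      consider "r = 0" | "r = 1" | "r = 2" using assms by linarith
      then show ?thesis using False by cases (simp; presburger)+
    qed
    with False Suc show ?thesis
      by simp
  qed
qed

lemma alternating_sum_interval_residue_class:
  assumes "r < 3" and "a \<le> b"
  shows "(\<Sum>p\<in>{a..<b}. if p mod 3 = r then (-1) ^ p else (0::real)) \<in> {-1, 0, 1}"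
proof -
  have "(\<Sum>p\<in>{a..<b}. if p mod 3 = r then (-1) ^ p else (0::real)) =
      (\<Sum>p<b. if p mod 3 = r then (-1) ^ p else 0) - (\<Sum>p<a. if p mod 3 = r then (-1) ^ p else 0)"
    using sum.atLeastLessThan_concat[of 0 a b "\<lambda>p. if p mod 3 = r then (-1) ^ p else (0::real)"] assms(2)
    by (simp add: lessThan_atLeast0)
  then show ?thesis
    unfolding alternating_sum_residue_class[OF assms(1)]
    by (auto simp: minus_one_power_iff)
qed

section \<open>A tight direction at a fractional cover\<close>

lemma Ints_complement: "(x::real) + y = 1 \<Longrightarrow> x \<in> \<int> \<longleftrightarrow> y \<in> \<int>"
  using Ints_diff[of 1 x] Ints_diff[of 1 y] by (auto simp: eq_diff_eq[symmetric])

text \<open>The case of a single path of tight edges. On the path \<open>y p\<close> is congruent to \<open>(-1) ^ p * \<beta>\<close>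
  modulo 1 for a fixed \<open>\<beta> \<notin> \<int>\<close>, so an integral weight of the class makes \<open>T * \<beta>\<close> an integer,
  where \<open>T \<in> {-1, 0, 1}\<close> is the alternating sum in question.\<close>

lemma single_run_direction_vanishes_on_class:
  fixes y :: "nat \<Rightarrow> real"
  assumes frac: "\<And>p. p < n \<Longrightarrow> y p \<notin> \<int> \<longleftrightarrow> a \<le> p \<and> p \<le> e" and ae: "a \<le> e" "e < n"
    and tight: "\<And>p. a \<le> p \<Longrightarrow> p < e \<Longrightarrow> y p + y (Suc p) = 1"
    and r: "r < 3" and total: "sum y (residue_class n r) \<in> \<int>"
  shows "(\<Sum>p\<in>residue_class n r. if y p \<notin> \<int> then (-1) ^ p else 0) = (0::real)"
proof -
  define \<beta> where "\<beta> = (-1) ^ a * y a"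
  define T :: real where "T = (\<Sum>p\<in>residue_class n r. if y p \<notin> \<int> then (-1) ^ p else 0)"
  have beta: "\<beta> \<notin> \<int>"
    using frac[of a] ae by (auto simp: \<beta>_def minus_one_power_iff)
  have run: "y p - (-1) ^ p * \<beta> \<in> \<int>" if "a \<le> p" "p \<le> e" for p
    using that
  proof (induction p rule: dec_induct)
    case base
    then show ?case by (simp add: \<beta>_def flip: mult.assoc power_add)
  next
    case (step p)
    then have "y (Suc p) - (-1) ^ Suc p * \<beta> = 1 - (y p - (-1) ^ p * \<beta>)"
      using tight[of p] by simp
    moreover have "1 - (y p - (-1) ^ p * \<beta>) \<in> \<int>"
      using step by (intro Ints_diff[OF Ints_1]) auto
    ultimately show ?case by (simp only:)
  qed
  have "y p - (if y p \<notin> \<int> then (-1) ^ p else 0) * \<beta> \<in> \<int>" if "p < n" for p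
    using run[of p] frac[OF that] by auto
  then have "(\<Sum>p\<in>residue_class n r. y p - (if y p \<notin> \<int> then (-1) ^ p else 0) * \<beta>) \<in> \<int>"
    by (intro Ints_sum) (auto simp: residue_class_def)
  then have "sum y (residue_class n r) - T * \<beta> \<in> \<int>"
    by (simp add: sum_subtractf sum_distrib_right T_def)
  with total have Tb: "T * \<beta> \<in> \<int>"
    using Ints_diff[OF total] by fastforce
  have "T = (\<Sum>p\<in>{a..<Suc e}. if p mod 3 = r then (-1) ^ p else 0)"
  proof -
    have "T = sum (\<lambda>p. (-1) ^ p) {p \<in> residue_class n r. y p \<notin> \<int>}"
      unfolding T_def by (rule sum.inter_filter[symmetric]) simp
    also have "{p \<in> residue_class n r. y p \<notin> \<int>} = {p \<in> {a..<Suc e}. p mod 3 = r}"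
    proof (intro Collect_cong)
      show "p \<in> residue_class n r \<and> y p \<notin> \<int> \<longleftrightarrow> p \<in> {a..<Suc e} \<and> p mod 3 = r" for p
        using frac[of p] ae(2) by (cases "p < n") (simp_all add: residue_class_def less_Suc_eq_le conj_commute)
    qed
    also have "sum (\<lambda>p. (-1) ^ p) \<dots> = (\<Sum>p\<in>{a..<Suc e}. if p mod 3 = r then (-1) ^ p else (0::real))"
      by (rule sum.inter_filter) simp
    finally show ?thesis .
  qed
  then have "T \<in> {-1, 0, 1}"
    using alternating_sum_interval_residue_class[OF r, of a "Suc e"] ae by simp
  with Tb beta show ?thesis
    unfolding T_def[symmetric] by auto
qed

text \<open>The combinatorial core. Integrality of \<open>y 0\<close> cuts the cycle open at 0, so that
  the sign \<open>(-1) ^ p\<close> is consistent along all fractional coordinates although \<open>n\<close> may be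
  odd.\<close>

lemma fractional_cover_has_tight_direction:
  fixes y :: "nat \<Rightarrow> real"
  assumes n: "n = 3 * \<nu>" "\<nu> \<ge> 3"
    and period: "y n = y 0" and cut: "y 0 \<in> \<int>"
    and edge: "\<And>p. p < n \<Longrightarrow> 1 \<le> y p + y (Suc p)"
    and frac: "\<exists>p<n. y p \<notin> \<int>"
  obtains d :: "nat \<Rightarrow> real" where
    "\<exists>p<n. d p \<noteq> 0"
    "\<And>p. y p \<in> \<int> \<Longrightarrow> d p = 0"
    "\<And>p. p < n \<Longrightarrow> y p + y (Suc p) = 1 \<Longrightarrow> d p + d (Suc p) = 0"
    "\<And>r. r < 3 \<Longrightarrow> sum y (residue_class n r) = 1 \<Longrightarrow> sum d (residue_class n r) = 0"
proof -
  \<comment> \<open>No tight edge joins two fractional coordinates across a splitting position, although there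
    are fractional coordinates on both sides of it.\<close>
  define splits where "splits b \<longleftrightarrow> (\<exists>p\<le>b. y p \<notin> \<int>) \<and> (\<exists>p. b < p \<and> p < n \<and> y p \<notin> \<int>) \<and>
      (y b \<in> \<int> \<or> y b + y (Suc b) \<noteq> 1)" for b
  show thesis
  proof (cases "\<exists>b<n. splits b")
    case True
    then obtain b p1 p2 where b: "y b \<in> \<int> \<or> y b + y (Suc b) \<noteq> 1" "b < n"
      and p: "p1 \<le> b" "y p1 \<notin> \<int>" "b < p2" "p2 < n" "y p2 \<notin> \<int>"
      unfolding splits_def by blast
    obtain r where r: "\<And>s. s < 3 \<Longrightarrow> sum y (residue_class n s) = 1 \<Longrightarrow> s = r"
    proof (cases "\<exists>r<3. sum y (residue_class n r) = 1")
      case True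
      then obtain r where "r < 3" "sum y (residue_class n r) = 1" by blast
      then show thesis
        using two_classes_not_both_tight[of \<nu> y _ r] n period edge by (intro that[of r]) simp
    next
      case False
      then show thesis using that by blast
    qed
    define f1 where "f1 p = (if y p \<notin> \<int> \<and> p \<le> b then (-1) ^ p else (0::real))" for p
    define f2 where "f2 p = (if y p \<notin> \<int> \<and> b < p then (-1) ^ p else (0::real))" for p
    define D1 where "D1 = sum f1 (residue_class n r)"
    define D2 where "D2 = sum f2 (residue_class n r)"
    \<comment> \<open>A combination of the left and right directions that annihilates the only class that can be
      tight. It is nonzero since both directions are, and have disjoint supports.\<close>
    obtain l m :: real where lm: "l \<noteq> 0 \<or> m \<noteq> 0" "l * D1 + m * D2 = 0"
    proof (cases "D1 = 0")
      case True
      then show thesis using that[of 1 0] by simp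
    next
      case False
      then show thesis using that[of D2 "- D1"] by simp
    qed
    show thesis
    proof
      let ?d = "\<lambda>p. l * f1 p + m * f2 p"
      have "?d p1 \<noteq> 0 \<or> ?d p2 \<noteq> 0" "p1 < n"
        using lm(1) p b(2) by (auto simp: f1_def f2_def)
      with p(4) show "\<exists>p<n. ?d p \<noteq> 0" by blast
      show "?d p = 0" if "y p \<in> \<int>" for p
        using that by (simp add: f1_def f2_def)
      show "?d p + ?d (Suc p) = 0" if "p < n" "y p + y (Suc p) = 1" for p
        using Ints_complement[OF that(2)] b that(2)
        by (cases "p = b") (auto simp: f1_def f2_def)
      show "sum ?d (residue_class n s) = 0" if "s < 3" "sum y (residue_class n s) = 1" for s
        using r[OF that] lm(2) by (simp add: sum.distrib D1_def D2_def flip: sum_distrib_left)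
    qed
  next
    case False
    \<comment> \<open>Without a splitting position the fractional coordinates form one run of tight edges.\<close>
    define F where "F = {p. p < n \<and> y p \<notin> \<int>}"
    have F: "finite F" "F \<noteq> {}"
      using frac by (auto simp: F_def)
    define a where "a = Min F"
    define e where "e = Max F"
    have ae: "a \<in> F" "e \<in> F" "a \<le> e" "\<And>p. p \<in> F \<Longrightarrow> a \<le> p \<and> p \<le> e"
      using F by (auto simp: a_def e_def)
    have run: "y p \<notin> \<int> \<and> y p + y (Suc p) = 1" if "a \<le> p" "p < e" for p
    proof -
      have "e < n" "y a \<notin> \<int>" "y e \<notin> \<int>" using ae by (auto simp: F_def)
      moreover have "\<not> splits p" using False that \<open>e < n\<close> by auto
      ultimately show ?thesis
        using that unfolding splits_def by blast
    qed
    have frac_iff: "y p \<notin> \<int> \<longleftrightarrow> a \<le> p \<and> p \<le> e" if "p < n" for p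
    proof
      show "a \<le> p \<and> p \<le> e" if "y p \<notin> \<int>"
        using ae(4)[of p] that \<open>p < n\<close> by (simp add: F_def)
      show "y p \<notin> \<int>" if "a \<le> p \<and> p \<le> e"
        using that run[of p] ae(2) by (cases "p = e") (simp_all add: F_def)
    qed
    show thesis
    proof
      let ?d = "\<lambda>p. if y p \<notin> \<int> then (-1) ^ p else (0::real)"
      show "\<exists>p<n. ?d p \<noteq> 0" using frac by auto
      show "?d p = 0" if "y p \<in> \<int>" for p
        using that by simp
      show "?d p + ?d (Suc p) = 0" if "p < n" "y p + y (Suc p) = 1" for p
        using Ints_complement[OF that(2)] by simp
      show "sum ?d (residue_class n s) = 0" if "s < 3" "sum y (residue_class n s) = 1" for s
      proof (rule single_run_direction_vanishes_on_class[OF frac_iff \<open>a \<le> e\<close> _ _ \<open>s < 3\<close>])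
        show "e < n" using ae(2) by (simp add: F_def)
        show "sum y (residue_class n s) \<in> \<int>" using that(2) by simp
      qed (use run in blast)+
    qed
  qed
qed

section \<open>The matrix in rotated coordinates\<close>

text \<open>The numbering of coordinates that starts at \<open>\<phi> (s + 1)\<close>. It moves an arbitrary coordinate to
  position 0 and is defined on all of \<open>nat\<close>, so that \<open>Suc\<close> is the cyclic successor.\<close>

definition rotated :: "(nat \<Rightarrow> 'n) \<Rightarrow> nat \<Rightarrow> nat \<Rightarrow> nat \<Rightarrow> 'n" where
  "rotated \<phi> n s p = \<phi> ((s + p) mod n + 1)"

lemma rotated_period: "rotated \<phi> n s n = rotated \<phi> n s 0"
  by (simp add: rotated_def)

lemma bij_betw_rotated:
  fixes \<phi> :: "nat \<Rightarrow> 'n::finite"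
  assumes "bij_betw \<phi> {1..n} UNIV"
  shows "bij_betw (rotated \<phi> n s) {..<n} UNIV"
proof -
  have n: "n > 0" using assms by (cases n) (auto simp: bij_betw_def)
  have inj: "inj_on (\<lambda>p. (s + p) mod n + 1) {..<n}"
  proof -
    have le: "p \<le> q" if "p < n" "(s + p) mod n = (s + q) mod n" for p q
    proof (rule ccontr)
      assume "\<not> p \<le> q"
      with that(2) have "n dvd p - q"
        using mod_eq_dvd_iff_nat[of "s + q" "s + p" n] by simp
      with that(1) \<open>\<not> p \<le> q\<close> show False
        by (auto dest: dvd_imp_le)
    qed
    show ?thesis
      by (rule inj_onI) (metis le add_right_cancel lessThan_iff order.antisym)
  qed
  have "(\<lambda>p. (s + p) mod n + 1) ` {..<n} \<subseteq> {1..n}"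
    using n by (auto simp: Suc_le_eq)
  with inj have "bij_betw (\<lambda>p. (s + p) mod n + 1) {..<n} {1..n}"
    by (simp add: bij_betw_def card_subset_eq card_image)
  from bij_betw_trans[OF this assms] show ?thesis
    by (simp add: rotated_def[abs_def] comp_def)
qed

lemma char_vec_inner: "char_vec S \<bullet> x = (\<Sum>j\<in>S. x $ j)"
proof -
  have "char_vec S \<bullet> x = (\<Sum>j\<in>UNIV. if j \<in> S then x $ j else 0)"
    unfolding inner_vec_def char_vec_def
    by (intro sum.cong) (auto simp: indicator_def)
  then show ?thesis
    by (simp flip: sum.inter_restrict)
qed

lemma E_matrix_edge_row:
  fixes \<phi> :: "nat \<Rightarrow> 'n::finite"
  assumes "bij_betw \<phi> {1..3 * \<nu>} UNIV" and "\<nu> > 0"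
  shows "(E_matrix \<phi> \<nu> *v x) $ Inl (rotated \<phi> (3 * \<nu>) s p)
       = x $ rotated \<phi> (3 * \<nu>) s p + x $ rotated \<phi> (3 * \<nu>) s (Suc p)"
proof -
  let ?t = "(s + p) mod (3 * \<nu>) + 1"
  have t: "?t \<in> {1..3 * \<nu>}" "?t mod (3 * \<nu>) + 1 \<in> {1..3 * \<nu>}"
    using assms(2) by (auto simp: Suc_le_eq)
  have "?t mod (3 * \<nu>) + 1 \<noteq> ?t"
    using t assms(2) by (cases "?t = 3 * \<nu>") auto
  with t assms(1) have "\<phi> ?t \<noteq> \<phi> (?t mod (3 * \<nu>) + 1)"
    by (metis bij_betw_imp_inj_on inj_onD)
  with circulant2_row[OF assms(1) t(1)] show ?thesis
    by (simp add: E_matrix_def append_rows_def matrix_vector_mul_component char_vec_inner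
        rotated_def mod_Suc_eq)
qed

text \<open>As 3 divides \<open>n\<close>, a rotation permutes the residue classes modulo 3.\<close>

lemma E_matrix_class_row:
  fixes \<phi> :: "nat \<Rightarrow> 'n::finite"
  assumes "bij_betw \<phi> {1..3 * \<nu>} UNIV" and "\<nu> > 0"
  obtains r where "r < 3" and
    "\<And>x. (E_matrix \<phi> \<nu> *v x) $ Inr i
       = (\<Sum>p\<in>residue_class (3 * \<nu>) r. x $ rotated \<phi> (3 * \<nu>) s p)"
proof -
  let ?n = "3 * \<nu>"
  obtain c where c: "c \<in> {1, 2, 3}" "E_matrix \<phi> \<nu> $ Inr i = step3_row \<phi> \<nu> c"
  proof -
    have "\<exists>c\<in>{1, 2, 3}. E_matrix \<phi> \<nu> $ Inr i = step3_row \<phi> \<nu> c"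
      using exhaust_3[of i] by (auto simp: E_matrix_def append_rows_def)
    with that show thesis by blast
  qed
  \<comment> \<open>Position \<open>p\<close> carries the number \<open>s + p + 1\<close>, so \<open>r\<close> has to be \<open>c - s - 1\<close> modulo 3; the
    form chosen avoids truncated subtraction.\<close>
  define r where "r = (c + 2 + 2 * s) mod 3"
  have "{\<phi> (c + 3 * j) | j. j < \<nu>} = {\<phi> t | t. t \<in> {1..?n} \<and> t mod 3 = c mod 3}"
  proof (intro Collect_cong iffI; elim exE conjE)
    fix v j assume "v = \<phi> (c + 3 * j)" "j < \<nu>"
    with c(1) show "\<exists>t. v = \<phi> t \<and> t \<in> {1..?n} \<and> t mod 3 = c mod 3"
      by (intro exI[of _ "c + 3 * j"]) auto
  next
    fix v t assume t: "v = \<phi> t" "t \<in> {1..?n}" "t mod 3 = c mod 3"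
    have "1 \<le> t" using t(2) by simp
    with t(3) c(1) have "c \<le> t" by (elim insertE emptyE; simp; presburger)
    with t(3) have "t = c + 3 * ((t - c) div 3)"
      by (metis dvd_mult_div_cancel le_add_diff_inverse mod_eq_dvd_iff_nat)
    moreover have "(t - c) div 3 < \<nu>" using t c(1) by auto
    ultimately show "\<exists>j. v = \<phi> (c + 3 * j) \<and> j < \<nu>" using t(1) by metis
  qed
  also have "\<dots> = rotated \<phi> ?n s ` residue_class ?n r"
  proof -
    have mod3: "((s + p) mod ?n + 1) mod 3 = c mod 3 \<longleftrightarrow> p mod 3 = r" for p
    proof -
      have "((s + p) mod ?n + 1) mod 3 = (s + p + 1) mod 3"
        by (rule mod_add_cong) (simp_all add: mod_mod_cancel)
      moreover have "(s + p + 1) mod 3 = c mod 3 \<longleftrightarrow> p mod 3 = r"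
      proof
        assume "(s + p + 1) mod 3 = c mod 3"
        then have "((s + p + 1) + (2 + 2 * s)) mod 3 = (c + (2 + 2 * s)) mod 3"
          by (rule mod_add_cong) simp
        also have "(s + p + 1) + (2 + 2 * s) = p + 3 * (s + 1)" by simp
        finally show "p mod 3 = r" unfolding r_def mod_mult_self2 by (simp only: add.assoc)
      next
        assume "p mod 3 = r"
        then have "(p + (s + 1)) mod 3 = ((c + 2 + 2 * s) + (s + 1)) mod 3"
          unfolding r_def by (rule mod_add_cong) simp
        also have "(c + 2 + 2 * s) + (s + 1) = c + 3 * (s + 1)" by simp
        finally show "(s + p + 1) mod 3 = c mod 3"
          unfolding mod_mult_self2 by (simp only: ac_simps)
      qed
      ultimately show ?thesis by simp
    qed
    have range: "(s + p) mod ?n + 1 \<in> {1..?n}" for p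
      using assms(2) by (auto simp: Suc_le_eq)
    show ?thesis
    proof (intro equalityI subsetI)
      fix v assume "v \<in> {\<phi> t | t. t \<in> {1..?n} \<and> t mod 3 = c mod 3}"
      then obtain t where t: "v = \<phi> t" "t \<in> {1..?n}" "t mod 3 = c mod 3" by blast
      obtain p where p: "p < ?n" "v = rotated \<phi> ?n s p"
        using bij_betw_rotated[OF assms(1), of s] by (metis bij_betw_def imageE lessThan_iff UNIV_I)
      with t range[of p] assms(1) have "t = (s + p) mod ?n + 1"
        unfolding rotated_def by (metis bij_betw_imp_inj_on inj_onD)
      with t(3) mod3[of p] p show "v \<in> rotated \<phi> ?n s ` residue_class ?n r"
        by (simp add: residue_class_def)
    next
      fix v assume "v \<in> rotated \<phi> ?n s ` residue_class ?n r"
      then obtain p where "p mod 3 = r" "v = \<phi> ((s + p) mod ?n + 1)"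
        by (auto simp: residue_class_def rotated_def)
      with mod3[of p] range[of p] show "v \<in> {\<phi> t | t. t \<in> {1..?n} \<and> t mod 3 = c mod 3}"
        by blast
    qed
  qed
  finally have S: "E_matrix \<phi> \<nu> $ Inr i = char_vec (rotated \<phi> ?n s ` residue_class ?n r)"
    using c by (simp add: step3_row_def)
  have "inj_on (rotated \<phi> ?n s) (residue_class ?n r)"
    using bij_betw_rotated[OF assms(1), of s]
    by (auto simp: bij_betw_def residue_class_def intro: inj_on_subset)
  then have "(E_matrix \<phi> \<nu> *v x) $ Inr i
      = (\<Sum>p\<in>residue_class ?n r. x $ rotated \<phi> ?n s p)" for x
    by (simp add: matrix_vector_mul_component S char_vec_inner sum.reindex)
  then show thesis
    using that[of r] by (simp add: r_def)
qed

section \<open>Minimal nonideality\<close>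

lemma E_matrix_binary: "binary_matrix (E_matrix \<phi> \<nu>)"
proof -
  have "E_matrix \<phi> \<nu> $ r $ j \<in> {0, 1}" for r j
  proof (cases r)
    case (Inl t)
    then show ?thesis
      by (simp add: E_matrix_def append_rows_def circulant2_def Let_def char_vec_def indicator_def)
  next
    case (Inr i)
    then show ?thesis
      using exhaust_3[of i]
      by (auto simp: E_matrix_def append_rows_def step3_row_def char_vec_def indicator_def)
  qed
  then show ?thesis by (simp add: binary_matrix_def)
qed

lemma E_matrix_not_ideal:
  fixes \<phi> :: "nat \<Rightarrow> 'n::finite"
  assumes "n = 3 * \<nu>" and "odd n" and "\<nu> \<ge> 3" and bij: "bij_betw \<phi> {1..n} UNIV"
  shows "\<not> ideal_matrix (E_matrix \<phi> \<nu>)"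
proof -
  let ?E = "E_matrix \<phi> \<nu>"
  let ?\<psi> = "rotated \<phi> n 0"
  have bij\<psi>: "bij_betw ?\<psi> {..<n} UNIV"
    by (rule bij_betw_rotated[OF bij])
  have edge: "(?E *v x) $ Inl (?\<psi> p) = x $ ?\<psi> p + x $ ?\<psi> (Suc p)" for x p
    using E_matrix_edge_row[of \<phi> \<nu> x 0 p] assms by simp
  have ex: "\<exists>p<n. j = ?\<psi> p" for j
    using bij\<psi> by (metis bij_betw_def imageE lessThan_iff UNIV_I)
  have total: "(\<Sum>p<n. x $ ?\<psi> p) = sum (($) x) UNIV" for x :: "real^'n"
    by (rule sum.reindex_bij_betw[OF bij\<psi>])
  define h :: "real^'n" where "h = (\<chi> j. 1/2)"
  have "1 \<le> (?E *v h) $ r" for r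
  proof (cases r)
    case (Inl t)
    with ex[of t] edge show ?thesis by (auto simp: h_def)
  next
    case (Inr i)
    obtain r where "r < 3" "\<And>x. (?E *v x) $ Inr i = (\<Sum>p\<in>residue_class n r. x $ ?\<psi> p)"
      using E_matrix_class_row[of \<phi> \<nu> i 0] assms by auto
    with Inr assms show ?thesis
      by (simp add: h_def sum_residue_class del: sum_constant) simp
  qed
  then have "h \<in> Q ?E"
    by (simp add: Q_def less_eq_vec_def h_def)
  moreover have "h \<notin> Q_star ?E"
  proof
    have "Q_star ?E \<subseteq> {x. 1 \<bullet> x \<ge> (real n + 1) / 2}"
      unfolding Q_star_def
    proof (rule hull_minimal, safe)
      fix x :: "real^'n"
      assume int: "integral_vec x" and ge: "1 \<le> ?E *v x"
      have "(\<Sum>p<n. x $ ?\<psi> (Suc p)) = (\<Sum>p<n. x $ ?\<psi> p)"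
        using sum.lessThan_Suc_shift[of "\<lambda>p. x $ ?\<psi> p" n] by (simp add: rotated_period)
      then have "2 * (\<Sum>p<n. x $ ?\<psi> p) = (\<Sum>p<n. (?E *v x) $ Inl (?\<psi> p))"
        by (simp add: edge sum.distrib)
      also have "\<dots> \<ge> (\<Sum>p<n. 1)"
        using ge by (intro sum_mono) (simp add: less_eq_vec_def)
      finally have "2 * (\<Sum>p<n. x $ ?\<psi> p) \<ge> n" by simp
      \<comment> \<open>The weight is an integer, and twice an integer exceeds an odd lower bound.\<close>
      moreover have "(\<Sum>p<n. x $ ?\<psi> p) \<in> \<int>"
        using int by (intro Ints_sum) (auto simp: integral_vec_def)
      then obtain z where z: "(\<Sum>p<n. x $ ?\<psi> p) = of_int z"
        by (auto elim: Ints_cases)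
      ultimately have "2 * z \<ge> int n" by linarith
      with \<open>odd n\<close> have "2 * z \<ge> int n + 1" by presburger
      then have "(real n + 1) / 2 \<le> of_int z" by simp
      then show "(real n + 1) / 2 \<le> 1 \<bullet> x"
        using z total[of x] by (simp add: inner_vec_def)
    qed (rule convex_halfspace_ge)
    moreover assume "h \<in> Q_star ?E"
    ultimately have "(real n + 1) / 2 \<le> 1 \<bullet> h" by blast
    also have "1 \<bullet> h = (\<Sum>p<n. h $ ?\<psi> p)"
      by (simp add: total inner_vec_def)
    finally show False by (simp add: h_def)
  qed
  ultimately show ?thesis
    by (auto simp: ideal_matrix_def)
qed

lemma E_matrix_extreme_point_integral:
  fixes \<phi> :: "nat \<Rightarrow> 'n::finite"
  assumes n: "n = 3 * \<nu>" "\<nu> \<ge> 3" and bij: "bij_betw \<phi> {1..n} UNIV" and c: "c \<in> \<int>"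
    and ext: "x extreme_point_of (Q (E_matrix \<phi> \<nu>) \<inter> {x. x $ i = c})"
  shows "integral_vec x"
proof (rule ccontr)
  let ?E = "E_matrix \<phi> \<nu>"
  obtain t where "t \<in> {1..n}" "i = \<phi> t"
    using bij by (metis bij_betw_def imageE UNIV_I)
  define s where "s = t - 1"
  let ?\<psi> = "rotated \<phi> n s"
  have i: "?\<psi> 0 = i"
    using \<open>t \<in> {1..n}\<close> \<open>i = \<phi> t\<close> by (auto simp: rotated_def s_def)
  have bij\<psi>: "bij_betw ?\<psi> {..<n} UNIV"
    by (rule bij_betw_rotated[OF bij])
  have ex: "\<exists>p<n. j = ?\<psi> p" for j
    using bij\<psi> by (metis bij_betw_def imageE lessThan_iff UNIV_I)
  have edge: "(?E *v x) $ Inl (?\<psi> p) = x $ ?\<psi> p + x $ ?\<psi> (Suc p)" for x p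
    using E_matrix_edge_row[of \<phi> \<nu> x s p] n bij by simp
  have x: "x \<in> Q ?E" "x $ i = c"
    using ext by (auto simp: extreme_point_of_def)
  define y where "y p = x $ ?\<psi> p" for p
  assume "\<not> integral_vec x"
  then have y_frac: "\<exists>p<n. y p \<notin> \<int>"
    using ex unfolding integral_vec_def y_def by metis
  have y_edge: "1 \<le> y p + y (Suc p)" for p
    using x(1) edge[of x p] by (simp add: Q_def less_eq_vec_def y_def) metis
  have "y n = y 0" "y 0 \<in> \<int>"
    using x(2) c i by (auto simp: y_def rotated_period)
  obtain d :: "nat \<Rightarrow> real" where d:
    "\<exists>p<n. d p \<noteq> 0" "\<And>p. y p \<in> \<int> \<Longrightarrow> d p = 0"
    "\<And>p. p < n \<Longrightarrow> y p + y (Suc p) = 1 \<Longrightarrow> d p + d (Suc p) = 0"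
    "\<And>r. r < 3 \<Longrightarrow> sum y (residue_class n r) = 1 \<Longrightarrow> sum d (residue_class n r) = 0"
    by (rule fractional_cover_has_tight_direction
        [OF n \<open>y n = y 0\<close> \<open>y 0 \<in> \<int>\<close> y_edge y_frac]) (rule that; blast)
  define D :: "real^'n" where "D = (\<chi> j. d (the_inv_into {..<n} ?\<psi> j))"
  have D: "D $ ?\<psi> p = d p" if "p < n" for p
    using bij\<psi> that by (simp add: D_def bij_betw_def the_inv_into_f_f)
  \<comment> \<open>The edge that closes the cycle needs the value at \<open>n\<close> too: it is 0, like the value at 0.\<close>
  have D_n: "D $ ?\<psi> n = d n"
    using D[of 0] d(2)[of 0] d(2)[of n] \<open>y n = y 0\<close> \<open>y 0 \<in> \<int>\<close> n by (simp add: rotated_period)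
  have "D = 0"
  proof (rule extreme_point_tight_direction[OF ext])
    show "D $ i = 0"
      using D[of 0] d(2)[of 0] \<open>y 0 \<in> \<int>\<close> n i by simp
    show "D $ j = 0" if "x $ j = 0" for j
    proof -
      obtain p where "p < n" "j = ?\<psi> p" using ex by blast
      with that D d(2)[of p] show ?thesis by (simp add: y_def)
    qed
    show "(?E *v D) $ r = 0" if r: "(?E *v x) $ r = 1" for r
    proof (cases r)
      case (Inl j)
      obtain p where p: "p < n" "j = ?\<psi> p" using ex by blast
      have "D $ ?\<psi> (Suc p) = d (Suc p)"
        using D D_n p(1) by (cases "Suc p = n") auto
      with p Inl r d(3)[of p] D show ?thesis
        by (simp add: edge y_def)
    next
      case (Inr k)
      obtain q where q: "q < 3" "\<And>x. (?E *v x) $ Inr k = (\<Sum>p\<in>residue_class n q. x $ ?\<psi> p)"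
        using E_matrix_class_row[of \<phi> \<nu> k s] n bij by auto
      have "(\<Sum>p\<in>residue_class n q. D $ ?\<psi> p) = sum d (residue_class n q)"
        by (intro sum.cong) (auto simp: D residue_class_def)
      with q Inr r d(4)[of q] show ?thesis
        by (simp add: y_def)
    qed
  qed
  with d(1) D show False by force
qed

theorem theorem6p11:
  fixes \<nu> n :: nat and \<phi> :: "nat \<Rightarrow> 'n::finite"
  assumes "n = 3 * \<nu>" and "odd n" and "\<nu> \<ge> 3"
    and "bij_betw \<phi> {1..n} UNIV"
  shows "minimally_nonideal (E_matrix \<phi> \<nu>)"
  unfolding minimally_nonideal_def integral_polyhedron_def
  using E_matrix_binary E_matrix_not_ideal[OF assms] Q_fixed_coordinate_polyhedron
    E_matrix_extreme_point_integral[OF assms(1,3,4)]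
  by (metis Ints_0 Ints_1)

end
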